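(* Let $p,q\ge0$ be integers with $p\le q+1$, let $\mathbf{a}=(a_1,\dots,a_p)$, $\mathbf{b}=(b_1,\dots,b_q)$ be vectors with positive components, and write $F(x)={}_pF_q(\mathbf{a};\mathbf{b};x)$. (i) If $p\le q$ and $$\frac{e_q(\mathbf{b})}{e_p(\mathbf{a})}\le\frac{e_{q-1}(\mathbf{b})}{e_{p-1}(\mathbf{a})}\le\cdots\le\frac{e_{q-p+1}(\mathbf{b})}{e_1(\mathbf{a})}\le e_{q-p}(\mathbf{b}),$$ then $F$ is log-concave on $(0,\infty)$, which is equivalent to the Laguerre inequality $F'(x)^2-F(x)F''(x)\ge0$ for $x\in(0,\infty)$. (ii) If $p\ge q$ and $$\frac{e_p(\mathbf{a})}{e_q(\mathbf{b})}\le\frac{e_{p-1}(\mathbf{a})}{e_{q-1}(\mathbf{b})}\le\cdots\le\frac{e_{p-q+1}(\mathbf{a})}{e_1(\mathbf{b})}\le e_{p-q}(\mathbf{a}),$$ then $F$ is log-convex and $F'(x)^2-F(x)F''(x)\le0$ on $(0,\infty)$ if $p=q$, and on $(0,1)$ if $p=q+1$.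
   Context: ${}_pF_q(\mathbf{a};\mathbf{b};z)=\sum_{n\ge0}\frac{(a_1)_n\cdots(a_p)_n}{(b_1)_n\cdots(b_q)_n\,n!}z^n$ is the generalized hypergeometric function, with $(a)_n=a(a+1)\cdots(a+n-1)$; the series converges for all $z$ if $p\le q$ and for $|z|<1$ if $p=q+1$. $e_m(\mathbf{c})=e_m(c_1,\dots,c_r)$ denotes the $m$-th elementary symmetric polynomial, with $e_0=1$. The chain in (i) means $e_{q-p+j}(\mathbf{b})/e_j(\mathbf{a})\le e_{q-p+j-1}(\mathbf{b})/e_{j-1}(\mathbf{a})$ for $j=1,\dots,p$; the chain in (ii) means $e_{p-q+j}(\mathbf{a})/e_j(\mathbf{b})\le e_{p-q+j-1}(\mathbf{a})/e_{j-1}(\mathbf{b})$ for $j=1,\dots,q$. *)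

theory Defs
  imports "HOL-Analysis.Analysis"
begin

(* The real function given by the sum of the pFq series, p = length a, q = length b.
   As eval_fps is a suminf, the value is meaningful only where the series converges. *)
definition pFq :: "real list \<Rightarrow> real list \<Rightarrow> real \<Rightarrow> real" where
  "pFq a b x = eval_fps (fps_hypergeo a b 1) x"

lemma pFq_eq_suminf:
  "pFq a b x =
     (\<Sum>n. (\<Prod>c\<leftarrow>a. pochhammer c n) / ((\<Prod>c\<leftarrow>b. pochhammer c n) * fact n) * x ^ n)"
proof -
  have "foldl (\<lambda>r c. r * pochhammer c n) v cs = v * (\<Prod>c\<leftarrow>cs. pochhammer c n)"
    for n and v :: real and cs
    by (induction cs arbitrary: v) (auto simp: mult.assoc)
  then show ?thesis
    by (simp add: pFq_def eval_fps_def)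
qed

(* Sum over sets of positions, so that repeated entries are counted with multiplicity. *)
definition elem_sym :: "nat \<Rightarrow> real list \<Rightarrow> real" where
  "elem_sym m c = (\<Sum>S | S \<subseteq> {..<length c} \<and> card S = m. \<Prod>i\<in>S. c ! i)"

lemma elem_sym_0: "elem_sym 0 c = 1"
proof -
  have "{S. S \<subseteq> {..<length c} \<and> card S = 0} = {{}}"
    by (auto dest: finite_subset)
  then show ?thesis
    by (simp add: elem_sym_def)
qed

(* Positivity is part of the notion, since ln is totalised. *)
definition log_concave_on :: "real set \<Rightarrow> (real \<Rightarrow> real) \<Rightarrow> bool" where
  "log_concave_on S f \<longleftrightarrow> (\<forall>x\<in>S. f x > 0) \<and> concave_on S (\<lambda>x. ln (f x))"

definition log_convex_on :: "real set \<Rightarrow> (real \<Rightarrow> real) \<Rightarrow> bool" where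
  "log_convex_on S f \<longleftrightarrow> (\<forall>x\<in>S. f x > 0) \<and> convex_on S (\<lambda>x. ln (f x))"

end

theory Submission
  imports Defs "HOL-Real_Asymp.Real_Asymp"
begin

text \<open>
  Write \<open>A(t)\<close> and \<open>B(t)\<close> for the products of the factors \<open>a_i + t\<close> and \<open>b_j + t\<close>, and
  \<open>F(x) = \<Sum> f_n x^n / n!\<close>. Then \<open>f_(n+1) / f_n = A(n) / B(n)\<close>. The coefficients of \<open>A\<close> and \<open>B\<close> are
  elementary symmetric polynomials, and the chain of inequalities in (i) says exactly that the
  quotients of the coefficients of \<open>B\<close> by those of \<open>A\<close> increase with the power of \<open>t\<close>.
  This makes \<open>B(t) / A(t)\<close> increasing for \<open>t \<ge> 0\<close> (\<open>prod_list_ratio_mono\<close>), so \<open>f_(n+1) / f_n\<close>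
  decreases and \<open>f\<close> is a log-concave sequence. Exchanging \<open>a\<close> and \<open>b\<close>, the chain in (ii) makes \<open>f\<close>
  log-convex.

  The Laguerre expression \<open>F'^2 - F F''\<close> is itself a power series, with \<open>n\<close>-th coefficient
  \<open>1 / n!\<close> times the sum over \<open>k \<le> n\<close> of \<open>(n choose k) d_k\<close>, where
  \<open>d_k = f_(k+1) f_(n+1-k) - f_k f_(n+2-k)\<close>. The numbers \<open>d_k\<close> change sign under
  \<open>k \<mapsto> n + 1 - k\<close>, and for log-concave \<open>f\<close> they are nonnegative in the lower half of the range.
  The binomial weight of \<open>k\<close> there is at least that of \<open>n + 1 - k\<close>, so the nonnegative terms
  prevail (\<open>binomial_sum_antisymmetric_nonneg\<close>). Hence all coefficients of the Laguerre
  expression have one sign, and so has its value at every positive \<open>x\<close> in the disc of convergence.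
  Finally \<open>(ln F)'' = - (F'^2 - F F'') / F^2\<close> turns that sign into log-concavity or log-convexity.
\<close>

section \<open>Ratios of products and elementary symmetric polynomials\<close>

lemma elem_sym_pos:
  assumes "\<forall>x\<in>set c. x > 0" "m \<le> length c"
  shows "elem_sym m c > 0"
  unfolding elem_sym_def
proof (rule sum_pos)
  show "finite {S. S \<subseteq> {..<length c} \<and> card S = m}"
    by (rule finite_subset[of _ "Pow {..<length c}"]) auto
  have "{..<m} \<in> {S. S \<subseteq> {..<length c} \<and> card S = m}"
    using assms(2) by auto
  then show "{S. S \<subseteq> {..<length c} \<and> card S = m} \<noteq> {}"
    by blast
  show "0 < (\<Prod>i\<in>S. c ! i)" if "S \<in> {S. S \<subseteq> {..<length c} \<and> card S = m}" for S
    using that assms(1) by (intro prod_pos) (auto simp: subset_iff)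
qed

text \<open>
  Vieta's formula. Expanding the product picks the set of positions that contribute \<open>c ! i\<close>
  instead of \<open>t\<close>; these sets are then grouped by cardinality.
\<close>

lemma prod_list_add_eq_sum_elem_sym:
  "(\<Prod>x\<leftarrow>c. x + t) = (\<Sum>k\<le>length c. elem_sym k c * t ^ (length c - k))"
proof -
  let ?n = "length c"
  have "(\<Prod>x\<leftarrow>c. x + t) = (\<Prod>i<?n. c ! i + t)"
    by (simp add: prod.list_conv_set_nth atLeast0LessThan)
  also have "\<dots> = (\<Sum>S\<in>Pow {..<?n}. (\<Prod>i\<in>S. c ! i) * (\<Prod>i\<in>{..<?n} - S. t))"
    by (rule prod_add) simp
  also have "\<dots> = (\<Sum>S\<in>Pow {..<?n}. (\<Prod>i\<in>S. c ! i) * t ^ (?n - card S))"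
    by (rule sum.cong) (auto simp: card_Diff_subset finite_subset)
  also have "\<dots> = (\<Sum>k\<le>?n. \<Sum>S | S \<in> Pow {..<?n} \<and> card S = k.
                     (\<Prod>i\<in>S. c ! i) * t ^ (?n - card S))"
    by (rule sum.group[symmetric]) (auto dest!: subset_eq_atLeast0_lessThan_card[unfolded atLeast0LessThan])
  also have "\<dots> = (\<Sum>k\<le>?n. elem_sym k c * t ^ (?n - k))"
    by (rule sum.cong) (auto simp: elem_sym_def sum_distrib_right intro!: sum.cong)
  finally show ?thesis .
qed

text \<open>
  Indexing by the power of \<open>t\<close>, with zeros above the degree, aligns two products of different
  lengths: the comparison of their coefficients then does not involve the shift by the
  difference of the lengths.
\<close>

definition coeff_at_power :: "real list \<Rightarrow> nat \<Rightarrow> real" where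
  "coeff_at_power c m = (if m \<le> length c then elem_sym (length c - m) c else 0)"

lemma prod_list_add_eq_sum_coeff:
  assumes "length c \<le> M"
  shows "(\<Prod>x\<leftarrow>c. x + t) = (\<Sum>m\<le>M. coeff_at_power c m * t ^ m)"
proof -
  let ?n = "length c"
  have "(\<Sum>m\<le>M. coeff_at_power c m * t ^ m) = (\<Sum>m\<le>?n. coeff_at_power c m * t ^ m)"
    using assms by (intro sum.mono_neutral_right) (auto simp: coeff_at_power_def)
  also have "\<dots> = (\<Sum>k\<le>?n. elem_sym k c * t ^ (?n - k))"
    by (rule sum.reindex_bij_witness[of _ "\<lambda>k. ?n - k" "\<lambda>k. ?n - k"])
       (auto simp: coeff_at_power_def)
  finally show ?thesis
    by (simp add: prod_list_add_eq_sum_elem_sym)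
qed

text \<open>
  The cross-multiplied form says that \<open>v / u\<close> increases, and stays meaningful where \<open>u\<close> vanishes.
  The difference of the two sides is a double sum over \<open>(i, j)\<close>. Adding the summands at
  \<open>(i, j)\<close> and \<open>(j, i)\<close> gives the product
  \<open>(v i * u j - v j * u i) * (t ^ i * s ^ j - s ^ i * t ^ j)\<close>, whose two factors have the same sign.
\<close>

lemma poly_ratio_mono:
  fixes u v :: "nat \<Rightarrow> real"
  assumes cross: "\<And>i j. i \<le> j \<Longrightarrow> j \<le> M \<Longrightarrow> v i * u j \<le> v j * u i"
    and st: "0 \<le> s" "s \<le> t"
  shows "(\<Sum>i\<le>M. v i * s ^ i) * (\<Sum>j\<le>M. u j * t ^ j)
       \<le> (\<Sum>i\<le>M. v i * t ^ i) * (\<Sum>j\<le>M. u j * s ^ j)"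
proof -
  define w where "w i j = v i * u j * (t ^ i * s ^ j - s ^ i * t ^ j)" for i j
  have pos: "0 \<le> w i j + w j i" if "i \<le> j" "j \<le> M" for i j
  proof -
    have "t ^ i * s ^ j - s ^ i * t ^ j = s ^ i * t ^ i * (s ^ (j - i) - t ^ (j - i))"
    proof -
      from le_Suc_ex[OF that(1)] obtain e where "j = i + e" ..
      then show ?thesis
        by (simp add: power_add algebra_simps)
    qed
    also have "\<dots> \<le> 0"
      using st by (intro mult_nonneg_nonpos) (auto intro: power_mono)
    finally have "0 \<le> (v i * u j - v j * u i) * (t ^ i * s ^ j - s ^ i * t ^ j)"
      using cross[OF that] by (intro mult_nonpos_nonpos) auto
    also have "\<dots> = w i j + w j i"
      by (simp add: w_def algebra_simps)
    finally show ?thesis .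
  qed
  have pos': "0 \<le> w i j + w j i" if "i \<le> M" "j \<le> M" for i j
    using pos[of i j] pos[of j i] that by (cases "i \<le> j") (auto simp: add.commute)
  have swap: "(\<Sum>i\<le>M. \<Sum>j\<le>M. w i j) = (\<Sum>i\<le>M. \<Sum>j\<le>M. w j i)"
    by (rule sum.swap)
  have "0 \<le> (\<Sum>i\<le>M. \<Sum>j\<le>M. w i j + w j i)"
    by (intro sum_nonneg) (auto intro: pos')
  also have "\<dots> = 2 * (\<Sum>i\<le>M. \<Sum>j\<le>M. w i j)"
    using swap by (simp add: sum.distrib)
  also have "(\<Sum>i\<le>M. \<Sum>j\<le>M. w i j) =
      (\<Sum>i\<le>M. v i * t ^ i) * (\<Sum>j\<le>M. u j * s ^ j) - (\<Sum>i\<le>M. v i * s ^ i) * (\<Sum>j\<le>M. u j * t ^ j)"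
    unfolding sum_product sum_subtractf[symmetric] w_def
    by (intro sum.cong refl) (simp add: algebra_simps)
  finally show ?thesis by simp
qed

text \<open>
  With \<open>j = length a - m\<close> the chain compares the coefficient ratios at the powers \<open>m\<close> and \<open>m + 1\<close>.
  It is written with \<open>b\<close> as the longer list, which serves (i) directly and (ii) after exchanging
  \<open>a\<close> and \<open>b\<close>.
\<close>

lemma prod_list_ratio_mono:
  assumes pos: "\<forall>x\<in>set a. x > 0" "\<forall>x\<in>set b. x > 0"
    and len: "length a \<le> length b"
    and chain: "\<forall>j\<in>{1..length a}.
      elem_sym (length b - length a + j) b / elem_sym j a
        \<le> elem_sym (length b - length a + j - 1) b / elem_sym (j - 1) a"
    and st: "0 \<le> s" "s \<le> t"
  shows "(\<Prod>x\<leftarrow>b. x + s) * (\<Prod>x\<leftarrow>a. x + t) \<le> (\<Prod>x\<leftarrow>b. x + t) * (\<Prod>x\<leftarrow>a. x + s)"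
proof -
  let ?p = "length a" and ?q = "length b"
  define r where "r m = coeff_at_power b m / coeff_at_power a m" for m
  have apos: "coeff_at_power a m > 0" if "m \<le> ?p" for m
    using that elem_sym_pos[OF pos(1)] by (simp add: coeff_at_power_def)
  have bnn: "coeff_at_power b m \<ge> 0" for m
    using elem_sym_pos[OF pos(2), of "?q - m"] by (simp add: coeff_at_power_def less_imp_le)
  have ann: "coeff_at_power a m \<ge> 0" for m
    using elem_sym_pos[OF pos(1), of "?p - m"] by (simp add: coeff_at_power_def less_imp_le)
  have step: "r m \<le> r (Suc m)" if "Suc m \<le> ?p" for m
  proof -
    have "?q - ?p + (?p - m) = ?q - m" "?q - ?p + (?p - m) - 1 = ?q - Suc m" "?p - m - 1 = ?p - Suc m"
      using that len by auto
    then show ?thesis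
      using chain[rule_format, of "?p - m"] that len
      by (simp add: r_def coeff_at_power_def)
  qed
  have rmono: "r i \<le> r j" if "i \<le> j" "j \<le> ?p" for i j
    using that by (induction j rule: dec_induct) (auto intro: order_trans step)
  have "coeff_at_power b i * coeff_at_power a j \<le> coeff_at_power b j * coeff_at_power a i"
    if "i \<le> j" for i j
  proof (cases "j \<le> ?p")
    case True
    then show ?thesis
      using rmono[OF that True] apos[of i] apos[of j] that by (simp add: r_def field_simps)
  next
    \<comment> \<open>Above the degree of the smaller product its coefficients vanish, as if the ratio were infinite.\<close>
    case False
    then have "coeff_at_power a j = 0"
      by (simp add: coeff_at_power_def)
    then show ?thesis
      using ann bnn by simp
  qed
  then show ?thesis
    unfolding prod_list_add_eq_sum_coeff[OF len] prod_list_add_eq_sum_coeff[where c = b, OF order_refl]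
    by (intro poly_ratio_mono st) auto
qed

section \<open>Exponential generating functions of log-concave and log-convex sequences\<close>

text \<open>
  The reflection \<open>k \<mapsto> n + 1 - k\<close> sends the weight of \<open>k\<close> to \<open>n choose (n + 1 - k) = n choose (k - 1)\<close>,
  which for \<open>2 * k \<le> n + 1\<close> is at most \<open>n choose k\<close>. Averaging the sum with its reflection
  leaves the terms \<open>((n choose k) - (n choose (n + 1 - k))) * d k\<close>. Both factors are nonnegative
  in the lower half, and both change sign in the upper half.
\<close>

lemma binomial_sum_antisymmetric_nonneg:
  fixes d :: "nat \<Rightarrow> real"
  assumes anti: "\<And>k. k \<le> Suc n \<Longrightarrow> d (Suc n - k) = - d k"
    and nonneg: "\<And>k. 2 * k \<le> Suc n \<Longrightarrow> 0 \<le> d k"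
  shows "0 \<le> (\<Sum>k\<le>n. real (n choose k) * d k)"
proof -
  let ?N = "Suc n"
  \<comment> \<open>The range symmetric under the reflection is \<open>{..Suc n}\<close>; the added term has weight zero.\<close>
  have S1: "(\<Sum>k\<le>n. real (n choose k) * d k) = (\<Sum>k\<le>?N. real (n choose k) * d k)"
    by simp
  have S2: "(\<Sum>k\<le>?N. real (n choose k) * d k) = (\<Sum>k\<le>?N. - real (n choose (?N - k)) * d k)"
    by (rule sum.reindex_bij_witness[of _ "\<lambda>k. ?N - k" "\<lambda>k. ?N - k"]) (auto simp: anti)
  have half: "0 \<le> (real (n choose k) - real (n choose (?N - k))) * d k" if "2 * k \<le> ?N" for k
  proof -
    have "n choose (?N - k) \<le> n choose k"
    proof (cases "k = 0 \<or> 2 * k = ?N")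
      case False
      then have "n choose (?N - k) = n choose (k - 1)"
        using that by (subst binomial_symmetric) auto
      also have "\<dots> \<le> n choose k"
        using that False by (intro binomial_mono) auto
      finally show ?thesis .
    next
      case True
      then have "k = 0 \<or> ?N - k = k"
        by linarith
      then show ?thesis
        by (auto simp: binomial_eq_0)
    qed
    then show ?thesis
      using nonneg[OF that] by simp
  qed
  have term_nonneg: "0 \<le> (real (n choose k) - real (n choose (?N - k))) * d k" if "k \<le> ?N" for k
  proof (cases "2 * k \<le> ?N")
    case False
    then have "0 \<le> (real (n choose (?N - k)) - real (n choose (?N - (?N - k)))) * d (?N - k)"
      by (intro half) auto
    also have "\<dots> = (real (n choose k) - real (n choose (?N - k))) * d k"
      using that anti[OF that] by (simp add: algebra_simps)
    finally show ?thesis .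
  qed (rule half)
  have "0 \<le> (\<Sum>k\<le>?N. (real (n choose k) - real (n choose (?N - k))) * d k)"
    by (intro sum_nonneg term_nonneg) auto
  also have "\<dots> = 2 * (\<Sum>k\<le>?N. real (n choose k) * d k)"
    using S2 by (simp only: left_diff_distrib sum_subtractf) (simp add: sum_negf)
  finally show ?thesis
    unfolding S1 by (simp del: sum.atMost_Suc)
qed

definition laguerre_fps :: "'a::field_char_0 fps \<Rightarrow> 'a fps" where
  "laguerre_fps H = fps_deriv H * fps_deriv H - H * fps_deriv (fps_deriv H)"

text \<open>
  Differentiating an exponential generating function shifts the sequence, and the product of two
  of them is a binomial convolution.
\<close>

lemma laguerre_fps_egf_nth:
  fixes f :: "nat \<Rightarrow> real"
  shows "fps_nth (laguerre_fps (Abs_fps (\<lambda>n. f n / fact n))) n =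
    (\<Sum>k\<le>n. real (n choose k) * (f (Suc k) * f (Suc n - k) - f k * f (Suc (Suc n - k)))) / fact n"
proof -
  have deriv: "fps_deriv (Abs_fps (\<lambda>n. g n / fact n)) = Abs_fps (\<lambda>n. g (Suc n) / fact n)"
    for g :: "nat \<Rightarrow> real"
    by (simp add: fps_eq_iff divide_simps del: of_nat_Suc)
  show ?thesis
    unfolding laguerre_fps_def deriv fps_sub_nth fps_mult_nth sum_subtractf[symmetric]
      sum_divide_distrib atLeast0AtMost
    by (intro sum.cong refl) (auto simp: binomial_fact Suc_diff_le field_simps)
qed

lemma laguerre_fps_egf_log_concave:
  fixes f :: "nat \<Rightarrow> real"
  assumes "\<And>k l. k \<le> l \<Longrightarrow> f k * f (Suc l) \<le> f (Suc k) * f l"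
  shows "fps_nth (laguerre_fps (Abs_fps (\<lambda>n. f n / fact n))) n \<ge> 0"
proof -
  define d where "d k = f (Suc k) * f (Suc n - k) - f k * f (Suc (Suc n - k))" for k
  have "0 \<le> (\<Sum>k\<le>n. real (n choose k) * d k)"
  proof (rule binomial_sum_antisymmetric_nonneg)
    show "d (Suc n - k) = - d k" if "k \<le> Suc n" for k
      using that by (simp add: d_def)
    show "0 \<le> d k" if "2 * k \<le> Suc n" for k
      using that assms[of k "Suc n - k"] by (simp add: d_def)
  qed
  then show ?thesis
    by (simp add: laguerre_fps_egf_nth d_def)
qed

lemma laguerre_fps_egf_log_convex:
  fixes f :: "nat \<Rightarrow> real"
  assumes "\<And>k l. k \<le> l \<Longrightarrow> f (Suc k) * f l \<le> f k * f (Suc l)"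
  shows "fps_nth (laguerre_fps (Abs_fps (\<lambda>n. f n / fact n))) n \<le> 0"
proof -
  define d where "d k = f k * f (Suc (Suc n - k)) - f (Suc k) * f (Suc n - k)" for k
  have "0 \<le> (\<Sum>k\<le>n. real (n choose k) * d k)"
  proof (rule binomial_sum_antisymmetric_nonneg)
    show "d (Suc n - k) = - d k" if "k \<le> Suc n" for k
      using that by (simp add: d_def)
    show "0 \<le> d k" if "2 * k \<le> Suc n" for k
      using that assms[of k "Suc n - k"] by (simp add: d_def)
  qed
  also have "\<dots> = - (\<Sum>k\<le>n. real (n choose k) * (f (Suc k) * f (Suc n - k) - f k * f (Suc (Suc n - k))))"
    unfolding sum_negf[symmetric] d_def by (intro sum.cong refl) (simp add: algebra_simps)
  finally show ?thesis
    by (simp add: laguerre_fps_egf_nth divide_nonpos_pos)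
qed

section \<open>Logarithmic convexity and the sign of the Laguerre expression\<close>

text \<open>
  The direction from convexity rests on the graph lying above its tangents: the tangent
  inequalities at \<open>x\<close> and at \<open>y\<close> add up to monotonicity of the first derivative.
\<close>

lemma convex_on_iff_second_deriv_nonneg:
  fixes f :: "real \<Rightarrow> real"
  assumes S: "open S" "convex S"
    and f': "\<And>x. x \<in> S \<Longrightarrow> (f has_real_derivative f' x) (at x)"
    and f'': "\<And>x. x \<in> S \<Longrightarrow> (f' has_real_derivative f'' x) (at x)"
  shows "convex_on S f \<longleftrightarrow> (\<forall>x\<in>S. f'' x \<ge> 0)"
proof
  assume conv: "convex_on S f"
  have tangent: "f y - f x \<ge> f' x * (y - x)" if "x \<in> S" "y \<in> S" for x y
    using conv that S
    by (intro convex_on_imp_above_tangent[of S])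
       (auto simp: convex_connected interior_open intro: has_field_derivative_at_within f')
  have "mono_on S f'"
  proof (rule mono_onI)
    fix x y assume xy: "x \<in> S" "y \<in> S" "x \<le> y"
    have "f' x * (y - x) \<le> f' y * (y - x)"
      using tangent[of x y] tangent[of y x] xy by (simp add: algebra_simps)
    then show "f' x \<le> f' y"
      using xy by (cases "x = y") auto
  qed
  then show "\<forall>x\<in>S. f'' x \<ge> 0"
    using mono_on_imp_deriv_nonneg f'' S by (metis interior_open)
next
  assume "\<forall>x\<in>S. f'' x \<ge> 0"
  then show "convex_on S f"
    using S f' f'' by (intro f''_ge0_imp_convex[of S f f' f'']) auto
qed

lemma
  fixes F :: "real \<Rightarrow> real"
  assumes S: "open S" "convex S"
    and F: "\<And>x. x \<in> S \<Longrightarrow> F x > 0"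
    and F': "\<And>x. x \<in> S \<Longrightarrow> (F has_real_derivative F' x) (at x)"
    and F'': "\<And>x. x \<in> S \<Longrightarrow> (F' has_real_derivative F'' x) (at x)"
  shows log_convex_on_iff: "log_convex_on S F \<longleftrightarrow> (\<forall>x\<in>S. (F' x)\<^sup>2 - F x * F'' x \<le> 0)"
    and log_concave_on_iff: "log_concave_on S F \<longleftrightarrow> (\<forall>x\<in>S. (F' x)\<^sup>2 - F x * F'' x \<ge> 0)"
proof -
  define L where "L x = (F'' x * F x - F' x * F' x) / (F x * F x)" for x
  have d1: "((\<lambda>x. ln (F x)) has_real_derivative F' x / F x) (at x)" if "x \<in> S" for x
    using F[OF that] F'[OF that] by (auto intro!: derivative_eq_intros)
  have d2: "((\<lambda>x. F' x / F x) has_real_derivative L x) (at x)" if "x \<in> S" for x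
    unfolding L_def using DERIV_divide[OF F''[OF that] F'[OF that]] F[OF that] by simp
  have sign: "L x \<ge> 0 \<longleftrightarrow> (F' x)\<^sup>2 - F x * F'' x \<le> 0" "L x \<le> 0 \<longleftrightarrow> (F' x)\<^sup>2 - F x * F'' x \<ge> 0"
    if "x \<in> S" for x
    using F[OF that]
    by (auto simp: L_def zero_le_divide_iff divide_le_0_iff power2_eq_square mult.commute zero_less_mult_iff mult_le_0_iff)
  show "log_convex_on S F \<longleftrightarrow> (\<forall>x\<in>S. (F' x)\<^sup>2 - F x * F'' x \<le> 0)"
    using convex_on_iff_second_deriv_nonneg[OF S d1 d2] F sign by (auto simp: log_convex_on_def)
  have "convex_on S (\<lambda>x. - ln (F x)) \<longleftrightarrow> (\<forall>x\<in>S. - L x \<ge> 0)"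
    by (rule convex_on_iff_second_deriv_nonneg[OF S DERIV_minus[OF d1] DERIV_minus[OF d2]])
  then show "log_concave_on S F \<longleftrightarrow> (\<forall>x\<in>S. (F' x)\<^sup>2 - F x * F'' x \<ge> 0)"
    using F sign by (auto simp: log_concave_on_def concave_on_def)
qed

lemma eval_fps_nonneg:
  fixes H :: "real fps"
  assumes "\<And>n. fps_nth H n \<ge> 0" "0 \<le> x" "ereal x < fps_conv_radius H"
  shows "0 \<le> eval_fps H x"
  unfolding eval_fps_def using assms summable_fps[of x H] by (intro suminf_nonneg) auto

lemma eval_fps_pos:
  fixes H :: "real fps"
  assumes "\<And>n. fps_nth H n > 0" "0 < x" "ereal x < fps_conv_radius H"
  shows "0 < eval_fps H x"
  unfolding eval_fps_def using assms summable_fps[of x H] by (intro suminf_pos) auto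

lemma
  fixes H :: "real fps"
  assumes "0 \<le> x" "ereal x < fps_conv_radius H"
  shows conv_radius_laguerre_fps: "ereal x < fps_conv_radius (laguerre_fps H)"
    and eval_laguerre_fps:
      "eval_fps (laguerre_fps H) x =
        (eval_fps (fps_deriv H) x)\<^sup>2 - eval_fps H x * eval_fps (fps_deriv (fps_deriv H)) x"
proof -
  have r: "ereal x < fps_conv_radius (fps_deriv H)" "ereal x < fps_conv_radius (fps_deriv (fps_deriv H))"
    using assms(2) fps_conv_radius_deriv[of H] fps_conv_radius_deriv[of "fps_deriv H"] by auto
  have m: "ereal x < fps_conv_radius (fps_deriv H * fps_deriv H)"
       "ereal x < fps_conv_radius (H * fps_deriv (fps_deriv H))"
    using r assms(2) by (auto intro!: less_le_trans[OF _ fps_conv_radius_mult])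
  show "ereal x < fps_conv_radius (laguerre_fps H)"
    unfolding laguerre_fps_def using m by (auto intro!: less_le_trans[OF _ fps_conv_radius_diff])
  show "eval_fps (laguerre_fps H) x =
        (eval_fps (fps_deriv H) x)\<^sup>2 - eval_fps H x * eval_fps (fps_deriv (fps_deriv H)) x"
    using m r assms by (simp add: laguerre_fps_def eval_fps_diff eval_fps_mult power2_eq_square)
qed

text \<open>
  The passage from \<open>deriv\<close> to formal derivatives. Taking the second derivative needs the first one
  to agree with the formal one on a whole neighbourhood of \<open>x\<close>.
\<close>

lemma
  fixes H :: "real fps"
  assumes "0 \<le> x" "ereal x < fps_conv_radius H"
  shows laguerre_deriv_eval_fps: "(deriv (eval_fps H) x)\<^sup>2 - eval_fps H x * deriv (deriv (eval_fps H)) x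
    = eval_fps (laguerre_fps H) x"
    and deriv_eval_fps_has_deriv:
      "(deriv (eval_fps H) has_real_derivative deriv (deriv (eval_fps H)) x) (at x)"
proof -
  let ?B = "eball 0 (fps_conv_radius H)"
  have d1: "deriv (eval_fps H) y = eval_fps (fps_deriv H) y" if "y \<in> ?B" for y
    using that by (subst eval_fps_deriv) auto
  have x: "x \<in> ?B"
    using assms by simp
  have "(eval_fps (fps_deriv H) has_real_derivative eval_fps (fps_deriv (fps_deriv H)) x) (at x)"
    using assms fps_conv_radius_deriv[of H] by (intro has_field_derivative_eval_fps) auto
  then have d2: "(deriv (eval_fps H) has_real_derivative eval_fps (fps_deriv (fps_deriv H)) x) (at x)"
    by (rule has_field_derivative_transform_within_open[where S = ?B]) (use x d1 in auto)
  then show "(deriv (eval_fps H) has_real_derivative deriv (deriv (eval_fps H)) x) (at x)"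
    by (simp add: DERIV_imp_deriv)
  show "(deriv (eval_fps H) x)\<^sup>2 - eval_fps H x * deriv (deriv (eval_fps H)) x
    = eval_fps (laguerre_fps H) x"
    using DERIV_imp_deriv[OF d2] d1[OF x] by (simp add: eval_laguerre_fps[OF assms])
qed

section \<open>The hypergeometric series\<close>

definition hypergeo_coeff :: "real list \<Rightarrow> real list \<Rightarrow> nat \<Rightarrow> real" where
  "hypergeo_coeff a b n = (\<Prod>x\<leftarrow>a. pochhammer x n) / (\<Prod>x\<leftarrow>b. pochhammer x n)"

lemma fps_hypergeo_eq_egf:
  "fps_hypergeo a b 1 = Abs_fps (\<lambda>n. hypergeo_coeff a b n / fact n)"
proof -
  have "foldl (\<lambda>r c. r * pochhammer c n) v cs = v * (\<Prod>c\<leftarrow>cs. pochhammer c n)"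
    for n and v :: real and cs
    by (induction cs arbitrary: v) (auto simp: mult.assoc)
  then show ?thesis
    by (simp add: fps_eq_iff hypergeo_coeff_def)
qed

lemma prod_list_pos:
  fixes g :: "'b \<Rightarrow> 'a::linordered_semidom"
  assumes "\<forall>x\<in>set c. g x > 0"
  shows "(\<Prod>x\<leftarrow>c. g x) > 0"
  using assms by (induction c) auto

lemma hypergeo_coeff_Suc:
  "hypergeo_coeff a b (Suc n) =
     (\<Prod>x\<leftarrow>a. x + real n) / (\<Prod>x\<leftarrow>b. x + real n) * hypergeo_coeff a b n"
proof -
  have "(\<Prod>x\<leftarrow>c. pochhammer x (Suc n)) = (\<Prod>x\<leftarrow>c. x + real n) * (\<Prod>x\<leftarrow>c. pochhammer x n)"
    for c :: "real list"
    by (induction c) (auto simp: pochhammer_Suc mult_ac)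
  then show ?thesis
    by (simp add: hypergeo_coeff_def)
qed

lemma hypergeo_coeff_pos:
  assumes "\<forall>x\<in>set a. x > 0" "\<forall>x\<in>set b. x > 0"
  shows "hypergeo_coeff a b n > 0"
  using assms by (auto simp: hypergeo_coeff_def intro!: divide_pos_pos prod_list_pos pochhammer_pos)

text \<open>
  The ratio of consecutive coefficients at \<open>n\<close> is at most the one at \<open>m\<close>. This serves
  log-concavity with \<open>m \<le> n\<close> and log-convexity with \<open>n \<le> m\<close>.
\<close>

lemma hypergeo_coeff_cross_le:
  assumes pos: "\<forall>x\<in>set a. x > 0" "\<forall>x\<in>set b. x > 0"
    and le: "(\<Prod>x\<leftarrow>b. x + real m) * (\<Prod>x\<leftarrow>a. x + real n)
           \<le> (\<Prod>x\<leftarrow>b. x + real n) * (\<Prod>x\<leftarrow>a. x + real m)"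
  shows "hypergeo_coeff a b m * hypergeo_coeff a b (Suc n)
       \<le> hypergeo_coeff a b (Suc m) * hypergeo_coeff a b n"
proof -
  define R where "R k = (\<Prod>x\<leftarrow>a. x + real k) / (\<Prod>x\<leftarrow>b. x + real k)" for k
  have bpos: "(\<Prod>x\<leftarrow>b. x + real k) > 0" for k
    using pos by (auto intro!: prod_list_pos add_pos_nonneg)
  have "R n \<le> R m"
    using le bpos[of m] bpos[of n] by (simp add: R_def field_simps)
  then have "R n * (hypergeo_coeff a b m * hypergeo_coeff a b n)
      \<le> R m * (hypergeo_coeff a b m * hypergeo_coeff a b n)"
    using hypergeo_coeff_pos[OF pos] by (intro mult_right_mono) (auto simp: less_imp_le)
  then show ?thesis
    by (simp add: hypergeo_coeff_Suc R_def[symmetric] mult_ac)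
qed

lemma prod_list_add_asymp:
  fixes c :: "real list"
  shows "(\<lambda>n. (\<Prod>x\<leftarrow>c. x + real n) / (real n + 1) ^ length c) \<longlonglongrightarrow> 1"
proof (induction c)
  case (Cons y c)
  have "(\<lambda>n. (y + real n) / (real n + 1)) \<longlonglongrightarrow> 1"
    by real_asymp
  from tendsto_mult[OF this Cons.IH] show ?case
    by simp
qed simp

text \<open>
  Ratio test: up to a factor tending to 1, the quotient of the \<open>n\<close>-th coefficient by the next one
  is \<open>(n + 1) ^ (length b + 1 - length a)\<close>.
\<close>

lemma fps_conv_radius_hypergeo:
  assumes pos: "\<forall>x\<in>set a. x > 0" "\<forall>x\<in>set b. x > 0"
  shows "length a \<le> length b \<Longrightarrow> fps_conv_radius (fps_hypergeo a b (1::real)) = \<infinity>"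
    and "length a = length b + 1 \<Longrightarrow> fps_conv_radius (fps_hypergeo a b (1::real)) = 1"
proof -
  define c where "c n = fps_nth (fps_hypergeo a b (1::real)) n" for n
  define A where "A n = (\<Prod>x\<leftarrow>a. x + real n) / (real n + 1) ^ length a" for n
  define B where "B n = (\<Prod>x\<leftarrow>b. x + real n) / (real n + 1) ^ length b" for n
  have cpos: "c n > 0" for n
    using hypergeo_coeff_pos[OF pos] by (simp add: c_def fps_hypergeo_eq_egf del: fps_hypergeo_nth)
  have BA: "(\<lambda>n. B n / A n) \<longlonglongrightarrow> 1"
    using tendsto_divide[OF prod_list_add_asymp[of b] prod_list_add_asymp[of a]]
    by (simp add: A_def B_def)
  have ratio: "norm (c n) / norm (c (Suc n)) =
      B n / A n * ((real n + 1) ^ Suc (length b) / (real n + 1) ^ length a)" for n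
  proof -
    have "(\<Prod>x\<leftarrow>a. x + real n) > 0" "(\<Prod>x\<leftarrow>b. x + real n) > 0"
      using pos by (auto intro!: prod_list_pos add_pos_nonneg)
    then show ?thesis
      using cpos[of n] cpos[of "Suc n"] hypergeo_coeff_pos[OF pos, of n]
      by (simp add: A_def B_def c_def fps_hypergeo_eq_egf hypergeo_coeff_Suc field_simps
               del: fps_hypergeo_nth)
  qed
  have nz: "eventually (\<lambda>n. c n \<noteq> 0) sequentially"
    using cpos by (simp add: less_imp_neq[symmetric])
  have rad: "fps_conv_radius (fps_hypergeo a b (1::real)) = conv_radius c"
    by (simp add: fps_conv_radius_def c_def[abs_def])
  show "fps_conv_radius (fps_hypergeo a b (1::real)) = \<infinity>" if "length a \<le> length b"
  proof -
    from le_Suc_ex[OF that] obtain d where "length b = length a + d" ..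
    then have d: "Suc (length b) = length a + Suc d"
      by simp
    have "filterlim (\<lambda>n. (real n + 1) ^ Suc d) at_top sequentially"
      by (intro filterlim_pow_at_top) (auto, real_asymp)
    then have "filterlim (\<lambda>n. B n / A n * (real n + 1) ^ Suc d) at_top sequentially"
      by (rule filterlim_tendsto_pos_mult_at_top[OF BA zero_less_one])
    also have "(\<lambda>n. B n / A n * (real n + 1) ^ Suc d) = (\<lambda>n. norm (c n) / norm (c (Suc n)))"
      unfolding ratio d power_add by (simp add: fun_eq_iff)
    finally show ?thesis
      unfolding rad by (intro conv_radius_ratio_limit_ereal[OF nz]) (simp add: tendsto_PInfty_eq_at_top)
  qed
  show "fps_conv_radius (fps_hypergeo a b (1::real)) = 1" if "length a = length b + 1"
  proof -
    have "(\<lambda>n. norm (c n) / norm (c (Suc n))) = (\<lambda>n. B n / A n)"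
      unfolding ratio that by (simp add: fun_eq_iff)
    then show ?thesis
      unfolding rad using BA by (intro conv_radius_ratio_limit[OF _ nz, of _ 1]) auto
  qed
qed

lemma
  fixes S :: "real set"
  assumes pos: "\<forall>x\<in>set a. x > 0" "\<forall>x\<in>set b. x > 0"
    and S: "open S" "convex S" "\<And>x. x \<in> S \<Longrightarrow> 0 < x \<and> ereal x < fps_conv_radius (fps_hypergeo a b (1::real))"
  shows log_concave_on_pFq_iff:
      "log_concave_on S (pFq a b) \<longleftrightarrow>
        (\<forall>x\<in>S. (deriv (pFq a b) x)\<^sup>2 - pFq a b x * deriv (deriv (pFq a b)) x \<ge> 0)"
    and log_convex_on_pFq_iff:
      "log_convex_on S (pFq a b) \<longleftrightarrow>
        (\<forall>x\<in>S. (deriv (pFq a b) x)\<^sup>2 - pFq a b x * deriv (deriv (pFq a b)) x \<le> 0)"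
proof -
  let ?H = "fps_hypergeo a b (1::real)"
  have H: "pFq a b = eval_fps ?H"
    by (simp add: pFq_def fun_eq_iff)
  have p: "pFq a b x > 0" if "x \<in> S" for x
    unfolding H using S(3)[OF that] hypergeo_coeff_pos[OF pos]
    by (intro eval_fps_pos) (auto simp: fps_hypergeo_eq_egf simp del: fps_hypergeo_nth)
  have d1: "(pFq a b has_real_derivative deriv (pFq a b) x) (at x)" if "x \<in> S" for x
    unfolding H using S(3)[OF that] has_field_derivative_eval_fps[of x ?H UNIV] DERIV_imp_deriv by force
  have d2: "(deriv (pFq a b) has_real_derivative deriv (deriv (pFq a b)) x) (at x)" if "x \<in> S" for x
    unfolding H using S(3)[OF that] by (intro deriv_eval_fps_has_deriv) auto
  show "log_concave_on S (pFq a b) \<longleftrightarrow>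
        (\<forall>x\<in>S. (deriv (pFq a b) x)\<^sup>2 - pFq a b x * deriv (deriv (pFq a b)) x \<ge> 0)"
    by (rule log_concave_on_iff[OF S(1,2) p d1 d2])
  show "log_convex_on S (pFq a b) \<longleftrightarrow>
        (\<forall>x\<in>S. (deriv (pFq a b) x)\<^sup>2 - pFq a b x * deriv (deriv (pFq a b)) x \<le> 0)"
    by (rule log_convex_on_iff[OF S(1,2) p d1 d2])
qed

lemma laguerre_pFq_nonneg:
  assumes pos: "\<forall>x\<in>set a. x > 0" "\<forall>x\<in>set b. x > 0"
    and len: "length a \<le> length b"
    and chain: "\<forall>j\<in>{1..length a}.
      elem_sym (length b - length a + j) b / elem_sym j a
        \<le> elem_sym (length b - length a + j - 1) b / elem_sym (j - 1) a"
    and x: "0 < x" "ereal x < fps_conv_radius (fps_hypergeo a b (1::real))"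
  shows "(deriv (pFq a b) x)\<^sup>2 - pFq a b x * deriv (deriv (pFq a b)) x \<ge> 0"
proof -
  let ?H = "fps_hypergeo a b (1::real)"
  have H: "pFq a b = eval_fps ?H"
    by (simp add: pFq_def fun_eq_iff)
  have "hypergeo_coeff a b k * hypergeo_coeff a b (Suc l)
      \<le> hypergeo_coeff a b (Suc k) * hypergeo_coeff a b l" if "k \<le> l" for k l
    using that by (intro hypergeo_coeff_cross_le pos prod_list_ratio_mono len chain) auto
  then have "fps_nth (laguerre_fps ?H) n \<ge> 0" for n
    unfolding fps_hypergeo_eq_egf by (rule laguerre_fps_egf_log_concave)
  then show ?thesis
    unfolding H using x by (simp add: laguerre_deriv_eval_fps eval_fps_nonneg conv_radius_laguerre_fps)
qed

lemma laguerre_pFq_nonpos: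
  assumes pos: "\<forall>x\<in>set a. x > 0" "\<forall>x\<in>set b. x > 0"
    and len: "length b \<le> length a"
    and chain: "\<forall>j\<in>{1..length b}.
      elem_sym (length a - length b + j) a / elem_sym j b
        \<le> elem_sym (length a - length b + j - 1) a / elem_sym (j - 1) b"
    and x: "0 < x" "ereal x < fps_conv_radius (fps_hypergeo a b (1::real))"
  shows "(deriv (pFq a b) x)\<^sup>2 - pFq a b x * deriv (deriv (pFq a b)) x \<le> 0"
proof -
  let ?H = "fps_hypergeo a b (1::real)"
  have H: "pFq a b = eval_fps ?H"
    by (simp add: pFq_def fun_eq_iff)
  have "hypergeo_coeff a b (Suc k) * hypergeo_coeff a b l
      \<le> hypergeo_coeff a b k * hypergeo_coeff a b (Suc l)" if "k \<le> l" for k l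
  proof -
    have "(\<Prod>x\<leftarrow>a. x + real k) * (\<Prod>x\<leftarrow>b. x + real l) \<le> (\<Prod>x\<leftarrow>a. x + real l) * (\<Prod>x\<leftarrow>b. x + real k)"
      using that by (intro prod_list_ratio_mono pos len chain) auto
    then show ?thesis
      using hypergeo_coeff_cross_le[OF pos, of l k] by (simp add: mult.commute)
  qed
  then have nonpos: "fps_nth (laguerre_fps ?H) n \<le> 0" for n
    unfolding fps_hypergeo_eq_egf by (rule laguerre_fps_egf_log_convex)
  have "0 \<le> eval_fps (- laguerre_fps ?H) x"
    using x nonpos conv_radius_laguerre_fps[of x ?H] by (intro eval_fps_nonneg) auto
  also have "\<dots> = - eval_fps (laguerre_fps ?H) x"
    using x conv_radius_laguerre_fps[of x ?H] by (subst eval_fps_minus) auto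
  finally show ?thesis
    unfolding H using x by (simp add: laguerre_deriv_eval_fps)
qed

theorem corollary1:
  fixes p q :: nat and a b :: "real list" and F :: "real \<Rightarrow> real"
  assumes "p \<le> q + 1"
    and "length a = p" and "length b = q"
    and "\<forall>c\<in>set a. c > 0" and "\<forall>c\<in>set b. c > 0"
  defines "F \<equiv> pFq a b"
  shows
    "(p \<le> q \<longrightarrow>
        (log_concave_on {0<..} F \<longleftrightarrow>
          (\<forall>x\<in>{0<..}. (deriv F x)\<^sup>2 - F x * deriv (deriv F) x \<ge> 0))) \<and>
     (p \<le> q \<and>
      (\<forall>j\<in>{1..p}. elem_sym (q - p + j) b / elem_sym j a
                   \<le> elem_sym (q - p + j - 1) b / elem_sym (j - 1) a) \<longrightarrow>
        log_concave_on {0<..} F \<and>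
        (\<forall>x\<in>{0<..}. (deriv F x)\<^sup>2 - F x * deriv (deriv F) x \<ge> 0)) \<and>
     (p \<ge> q \<and>
      (\<forall>j\<in>{1..q}. elem_sym (p - q + j) a / elem_sym j b
                   \<le> elem_sym (p - q + j - 1) a / elem_sym (j - 1) b) \<longrightarrow>
        (p = q \<longrightarrow>
          log_convex_on {0<..} F \<and>
          (\<forall>x\<in>{0<..}. (deriv F x)\<^sup>2 - F x * deriv (deriv F) x \<le> 0)) \<and>
        (p = q + 1 \<longrightarrow>
          log_convex_on {0<..<1} F \<and>
          (\<forall>x\<in>{0<..<1}. (deriv F x)\<^sup>2 - F x * deriv (deriv F) x \<le> 0)))"
proof -
  note pos = assms(4,5)
  have i: "log_concave_on {0<..} F \<longleftrightarrow> (\<forall>x\<in>{0<..}. (deriv F x)\<^sup>2 - F x * deriv (deriv F) x \<ge> 0)"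
    if "p \<le> q"
    unfolding F_def using that assms
    by (intro log_concave_on_pFq_iff pos) (auto simp: fps_conv_radius_hypergeo)
  have nonneg: "\<forall>x\<in>{0<..}. (deriv F x)\<^sup>2 - F x * deriv (deriv F) x \<ge> 0"
    if "p \<le> q" "\<forall>j\<in>{1..p}. elem_sym (q - p + j) b / elem_sym j a
                   \<le> elem_sym (q - p + j - 1) b / elem_sym (j - 1) a"
    unfolding F_def using that assms(2-3) pos
    by (intro ballI laguerre_pFq_nonneg) (auto simp: fps_conv_radius_hypergeo)
  have nonpos: "(deriv F x)\<^sup>2 - F x * deriv (deriv F) x \<le> 0"
    if "p \<ge> q" "\<forall>j\<in>{1..q}. elem_sym (p - q + j) a / elem_sym j b
                   \<le> elem_sym (p - q + j - 1) a / elem_sym (j - 1) b"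
      "0 < x" "ereal x < fps_conv_radius (fps_hypergeo a b (1::real))" for x
    unfolding F_def using that assms(2-3) pos
    by (intro laguerre_pFq_nonpos) auto
  have ii: "log_convex_on S F \<and> (\<forall>x\<in>S. (deriv F x)\<^sup>2 - F x * deriv (deriv F) x \<le> 0)"
    if "p \<ge> q" "\<forall>j\<in>{1..q}. elem_sym (p - q + j) a / elem_sym j b
                   \<le> elem_sym (p - q + j - 1) a / elem_sym (j - 1) b"
      "open S" "convex S" "\<And>x. x \<in> S \<Longrightarrow> 0 < x \<and> ereal x < fps_conv_radius (fps_hypergeo a b (1::real))"
    for S
    using log_convex_on_pFq_iff[OF pos that(3-5)] nonpos[OF that(1,2)] that(5)
    by (simp add: F_def)
  have ball: "p = q \<Longrightarrow> x \<in> {0<..} \<Longrightarrow> 0 < x \<and> ereal x < fps_conv_radius (fps_hypergeo a b (1::real))"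
    "p = q + 1 \<Longrightarrow> x \<in> {0<..<1} \<Longrightarrow> 0 < x \<and> ereal x < fps_conv_radius (fps_hypergeo a b (1::real))"
    for x :: real
    using fps_conv_radius_hypergeo[OF pos] assms(2,3) by auto
  show ?thesis
    using i nonneg ii[OF _ _ open_greaterThan _ ball(1)] ii[OF _ _ open_greaterThanLessThan _ ball(2)]
    by (intro conjI impI) (auto simp del: One_nat_def)
qed

end
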